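(* Let $f\in x+x^2\mathbb{C}[[x]]$ and let $\omega\in x+x^2\mathbb{C}[[x]]$ be the compositional inverse of $f(x)/f'(x)$. For $h\in\mathbb{C}[[x,s]]$ define $$(Kh)(x,s)=\frac{x}{\omega'(x)}\,\frac{\partial}{\partial x}\left[\frac{h(x,s)-h(s,s)}{x-s}\right]\in\mathbb{C}[[x,s]].$$ For $n\ge 0$ and $\varphi\in\mathbb{C}[[x]]$ (regarded as an element of $\mathbb{C}[[x,s]]$ not depending on $s$), set $T_n\varphi(s):=(K^n\varphi)(s,s)\in\mathbb{C}[[s]]$. Let $D=\frac{d}{ds}$ and let $\sigma$ denote the operator of multiplication by $\frac{s}{\omega'(s)}$ on $\mathbb{C}[[s]]$; products of operators below mean composition. Define operators $\alpha_i^{(n)}$ ($i,n\ge 0$) on $\mathbb{C}[[s]]$ recursively by $\alpha_0^{(0)}=1$, $\alpha_i^{(0)}=0$ for $i\ge1$, and $$\alpha_0^{(n+1)}=\sum_{i\ge 0}\frac{1}{(i+1)(i+2)}\,\alpha_i^{(n)}\sigma D^{i+2},\qquad \alpha_1^{(n+1)}=-\alpha_0^{(n)}\sigma D,\qquad \alpha_i^{(n+1)}=\frac1i\left(\alpha_{i-2}^{(n)}\sigma-\alpha_{i-1}^{(n)}\sigma D\right)\ (i\ge2)$$ (only finitely many $\alpha_i^{(n)}$ are nonzero for each $n$). Equivalently, $\alpha_i^{(n)}$ is the coefficient of $ED^i$ in $\nu^n(E)$, where $\nu$ is the map on expressions $\sum_i\alpha_iED^i$ (with coefficients $\alpha_i$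 noncommutative polynomials in $\sigma,D$) acting by $\alpha_iED^i\mapsto \alpha_i\big(\tfrac{1}{(i+1)(i+2)}\sigma D^{i+2}E-\tfrac{1}{i+1}\sigma DED^{i+1}+\tfrac1{i+2}\sigma ED^{i+2}\big)$, a term $cE$ being read as $cED^0$. Then for every $n\ge0$ and every $\varphi\in\mathbb{C}[[x]]$, $$T_n\varphi(s)=\alpha_0^{(n)}\varphi(s).$$ For instance $T_1=\tfrac12\sigma D^2$.
   Context: $\mathbb{C}[[x]]$, $\mathbb{C}[[x,s]]$ denote formal power series rings. The quotient $\frac{h(x,s)-h(s,s)}{x-s}$ is the (well-defined) divided difference in the first variable, an element of $\mathbb{C}[[x,s]]$; $1/\omega'(x)$ is well defined since $\omega'(0)=1$. *)

theory Defs
  imports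
    "HOL-Computational_Algebra.Formal_Power_Series"
    "HOL-Library.Poly_Mapping"
begin

section \<open>Power series in two variables\<close>

text \<open>
  The ring \<open>C[[x,s]]\<close> is rendered as \<open>C[[s]][[x]]\<close>, i.e. as \<^typ>\<open>complex fps fps\<close>: the outer variable
  is \<open>x\<close> and the coefficients are power series in \<open>s\<close>. Thus \<open>fps_nth (fps_nth h i) j\<close> is the
  coefficient of \<open>x^i s^j\<close>, the variable \<open>x\<close> is \<^term>\<open>fps_X :: complex fps fps\<close>, the variable \<open>s\<close> is
  \<^term>\<open>fps_const fps_X :: complex fps fps\<close>, a series in \<open>s\<close> alone is embedded by \<^const>\<open>fps_const\<close>,
  and the partial derivative with respect to \<open>x\<close> is \<^const>\<open>fps_deriv\<close>.
\<close>

definition in_x :: "complex fps \<Rightarrow> complex fps fps" where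
  "in_x \<phi> = Abs_fps (\<lambda>i. fps_const (fps_nth \<phi> i))"

text \<open>The substitution \<open>h(s,s)\<close>.\<close>

definition diag :: "complex fps fps \<Rightarrow> complex fps" where
  "diag h = Abs_fps (\<lambda>n. \<Sum>i\<le>n. fps_nth (fps_nth h i) (n - i))"

text \<open>The quotient of \<open>h(x,s) - h(s,s)\<close> by \<open>x - s\<close>; it is well defined by \<open>div_diff_ex1\<close> below.\<close>

definition div_diff :: "complex fps fps \<Rightarrow> complex fps fps" where
  "div_diff h = (THE q. (fps_X - fps_const fps_X) * q = h - fps_const (diag h))"

lemma div_diff_ex1: "\<exists>!q. (fps_X - fps_const fps_X) * q = h - fps_const (diag h)"
proof (rule ex_ex1I)
  let ?q = "Abs_fps (\<lambda>j. Abs_fps (\<lambda>m. \<Sum>k\<le>m. fps_nth (fps_nth h (Suc (j + k))) (m - k)))"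
  have "fps_nth (fps_nth ((fps_X - fps_const fps_X) * ?q) j) m
          = fps_nth (fps_nth (h - fps_const (diag h)) j) m" for j m
  proof (cases j)
    case 0
    then show ?thesis
      by (cases m)
        (simp_all add: left_diff_distrib diag_def sum.atMost_Suc_shift del: sum.atMost_Suc)
  next
    case (Suc i)
    then show ?thesis
      by (cases m)
        (simp_all add: left_diff_distrib sum.atMost_Suc_shift del: sum.atMost_Suc)
  qed
  then show "\<exists>q. (fps_X - fps_const fps_X) * q = h - fps_const (diag h)"
    by (intro exI[of _ ?q] fps_ext)
next
  fix q r
  assume "(fps_X - fps_const fps_X) * q = h - fps_const (diag h)"
    and "(fps_X - fps_const fps_X) * r = h - fps_const (diag h)"
  moreover have "fps_X - fps_const fps_X \<noteq> (0 :: complex fps fps)"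
  proof
    assume "fps_X - fps_const fps_X = (0 :: complex fps fps)"
    then have "fps_nth (fps_X - fps_const fps_X :: complex fps fps) 1 = 0"
      by simp
    then show False
      by simp
  qed
  ultimately show "q = r"
    by (metis mult_left_cancel)
qed

definition K :: "complex fps \<Rightarrow> complex fps fps \<Rightarrow> complex fps fps" where
  "K \<omega> h = in_x (fps_X / fps_deriv \<omega>) * fps_deriv (div_diff h)"

definition T :: "complex fps \<Rightarrow> nat \<Rightarrow> complex fps \<Rightarrow> complex fps" where
  "T \<omega> n \<phi> = diag ((K \<omega> ^^ n) (in_x \<phi>))"


section \<open>The recursively defined operators\<close>

abbreviation D :: "complex fps \<Rightarrow> complex fps" where
  "D \<equiv> fps_deriv"

definition \<sigma> :: "complex fps \<Rightarrow> complex fps \<Rightarrow> complex fps" where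
  "\<sigma> \<omega> g = fps_X / fps_deriv \<omega> * g"

text \<open>
  \<^term>\<open>\<alpha> \<omega> n i\<close> is the operator with lower index \<open>i\<close> and upper index \<open>n\<close>. The sum over all
  \<open>i \<ge> 0\<close> is \<^const>\<open>Sum_any\<close>, the sum of the nonzero terms; they are finitely many because
  \<^term>\<open>\<alpha> \<omega> n i\<close> vanishes for \<open>i > 2 * n\<close>.
\<close>

fun \<alpha> :: "complex fps \<Rightarrow> nat \<Rightarrow> nat \<Rightarrow> complex fps \<Rightarrow> complex fps" where
  "\<alpha> \<omega> 0 i = (\<lambda>\<phi>. if i = 0 then \<phi> else 0)"
| "\<alpha> \<omega> (Suc n) 0 =
     (\<lambda>\<phi>. Sum_any (\<lambda>i. fps_const (1 / (of_nat (i + 1) * of_nat (i + 2))) *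
                        \<alpha> \<omega> n i (\<sigma> \<omega> ((D ^^ (i + 2)) \<phi>))))"
| "\<alpha> \<omega> (Suc n) (Suc 0) = (\<lambda>\<phi>. - \<alpha> \<omega> n 0 (\<sigma> \<omega> (D \<phi>)))"
| "\<alpha> \<omega> (Suc n) (Suc (Suc i)) =
     (\<lambda>\<phi>. fps_const (1 / of_nat (i + 2)) *
           (\<alpha> \<omega> n i (\<sigma> \<omega> \<phi>) - \<alpha> \<omega> n (i + 1) (\<sigma> \<omega> (D \<phi>))))"


section \<open>The formal description by expressions\<close>

text \<open>
  Lists form a monoid under concatenation (written additively, as \<^theory>\<open>HOL-Library.Poly_Mapping\<close>
  requires), and the monoid algebra of words in two letters is the algebra of noncommutative
  polynomials in two indeterminates.
\<close>

instantiation list :: (type) monoid_add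
begin

definition zero_list :: "'a list" where "zero_list = []"

definition plus_list :: "'a list \<Rightarrow> 'a list \<Rightarrow> 'a list" where "plus_list = (@)"

instance
  by standard (simp_all add: zero_list_def plus_list_def)

end

datatype letter = Sigma_letter | D_letter

type_synonym nc_poly = "letter list \<Rightarrow>\<^sub>0 complex"

fun letter_op :: "complex fps \<Rightarrow> letter \<Rightarrow> complex fps \<Rightarrow> complex fps" where
  "letter_op \<omega> Sigma_letter = \<sigma> \<omega>"
| "letter_op \<omega> D_letter = D"

text \<open>The operator obtained from a noncommutative polynomial; products become compositions.\<close>

definition nc_op :: "complex fps \<Rightarrow> nc_poly \<Rightarrow> complex fps \<Rightarrow> complex fps" where
  "nc_op \<omega> p \<phi> =
     (\<Sum>w\<in>Poly_Mapping.keys p. fps_const (Poly_Mapping.lookup p w) * foldr (letter_op \<omega>) w \<phi>)"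

text \<open>
  The expression \<open>\<Sum>i. a i E D^i\<close> is represented by its finitely supported family of coefficients
  \<open>a i\<close>; in particular \<^term>\<open>Poly_Mapping.single 0 (1 :: nc_poly)\<close> is \<open>E\<close>.
\<close>

type_synonym expr = "nat \<Rightarrow>\<^sub>0 nc_poly"

definition \<nu>_term :: "nc_poly \<Rightarrow> nat \<Rightarrow> expr" where
  "\<nu>_term a i =
     Poly_Mapping.single 0
       (a * Poly_Mapping.single (Sigma_letter # replicate (i + 2) D_letter)
              (1 / (of_nat (i + 1) * of_nat (i + 2))))
     - Poly_Mapping.single (i + 1)
         (a * Poly_Mapping.single [Sigma_letter, D_letter] (1 / of_nat (i + 1)))
     + Poly_Mapping.single (i + 2)
         (a * Poly_Mapping.single [Sigma_letter] (1 / of_nat (i + 2)))"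

definition \<nu> :: "expr \<Rightarrow> expr" where
  "\<nu> e = (\<Sum>i\<in>Poly_Mapping.keys e. \<nu>_term (Poly_Mapping.lookup e i) i)"

end

theory Submission
  imports Defs
begin

text \<open>
  The statement is proved in the stronger form
  \<open>(K\<^sup>n h)(s,s) = \<Sum>i. \<alpha>\<^sub>i\<^sup>(\<^sup>n\<^sup>) ((\<partial>\<^sub>s\<^sup>i h)(s,s))\<close> for every \<open>h\<close> in \<open>C[[x,s]]\<close>, by induction
  on \<open>n\<close>; if \<open>h\<close> does not depend on \<open>s\<close>, only the term \<open>i = 0\<close> survives. For the step, write
  \<open>h(x,s) = g(s) + (x - s) q(x,s)\<close>, so that \<open>\<partial>\<^sub>s\<^sup>j h\<close> restricts to \<open>D\<^sup>j g - j \<partial>\<^sub>s\<^sup>j\<^sup>-\<^sup>1 q\<close> on the diagonal.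
  Together with the chain rule \<open>D (u(s,s)) = (\<partial>\<^sub>x u)(s,s) + (\<partial>\<^sub>s u)(s,s)\<close> this expresses
  \<open>(\<partial>\<^sub>s\<^sup>i \<partial>\<^sub>x q)(s,s)\<close> through \<open>g\<close> and the diagonal values of \<open>\<partial>\<^sub>s\<^sup>i\<^sup>+\<^sup>1 h\<close> and \<open>\<partial>\<^sub>s\<^sup>i\<^sup>+\<^sup>2 h\<close>, with the
  coefficients that occur in the recursion for \<open>\<alpha>\<close>.
\<close>

section \<open>Restriction to the diagonal and differentiation in s\<close>

definition deriv_s :: "complex fps fps \<Rightarrow> complex fps fps" where
  "deriv_s h = Abs_fps (\<lambda>i. fps_deriv (fps_nth h i))"

lemma deriv_s_nth [simp]: "fps_nth (deriv_s h) i = fps_deriv (fps_nth h i)"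
  by (simp add: deriv_s_def)

lemma diag_nth: "fps_nth (diag h) n = (\<Sum>i\<le>n. fps_nth (fps_nth h i) (n - i))"
  by (simp add: diag_def)

lemma diag_add: "diag (g + h) = diag g + diag h"
  by (rule fps_ext) (simp add: diag_nth sum.distrib)

lemma diag_diff: "diag (g - h) = diag g - diag h"
  by (rule fps_ext) (simp add: diag_nth sum_subtractf)

lemma diag_0 [simp]: "diag 0 = 0"
  by (rule fps_ext) (simp add: diag_nth)

lemma diag_of_nat_mult: "diag (of_nat k * h) = of_nat k * diag h"
  by (induction k) (simp_all add: algebra_simps diag_add)

lemma diag_fps_const [simp]: "diag (fps_const g) = g"
  by (rule fps_ext) (simp add: diag_nth if_distrib [of "\<lambda>a. fps_nth a _"] cong: if_cong)

text \<open>Setting x = s is multiplicative. In degree n both sides sum \<open>?g j i\<close> over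
  the triangle j + i \<le> n, once grouped by the total x-exponent and once by j.\<close>

lemma diag_in_x_mult: "diag (in_x \<phi> * h) = \<phi> * diag h"
proof (rule fps_ext)
  fix n
  let ?g = "\<lambda>j i. fps_nth \<phi> j * fps_nth (fps_nth h i) (n - (i + j))"
  have "fps_nth (diag (in_x \<phi> * h)) n = (\<Sum>i\<le>n. \<Sum>j\<le>i. ?g j (i - j))"
    by (simp only: diag_nth in_x_def fps_mult_nth [of "Abs_fps _"] fps_sum_nth fps_nth_Abs_fps
          fps_mult_left_const_nth atLeast0AtMost) simp
  also have "\<dots> = (\<Sum>(j, i)\<in>{(j, i). j + i \<le> n}. ?g j i)"
    by (rule sum.triangle_reindex_eq [symmetric])
  also have "\<dots> = (\<Sum>j\<le>n. \<Sum>i\<le>n - j. ?g j i)"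
    by (subst sum.Sigma) (auto intro!: sum.cong)
  also have "\<dots> = fps_nth (\<phi> * diag h) n"
    by (simp add: diag_nth fps_mult_nth sum_distrib_left atLeast0AtMost add.commute)
  finally show "fps_nth (diag (in_x \<phi> * h)) n = fps_nth (\<phi> * diag h) n" .
qed

lemma diag_in_x [simp]: "diag (in_x \<phi>) = \<phi>"
  using diag_in_x_mult [of \<phi> 1] diag_fps_const [of 1] by (simp del: diag_fps_const)

text \<open>Multiplication by x and multiplication by s both restrict to multiplication by s on the
  diagonal, so the two contributions cancel.\<close>

lemma diag_diff_mult: "diag ((fps_X - fps_const fps_X) * q) = 0"
proof -
  have X: "in_x fps_X = fps_X"
    by (rule fps_ext) (simp add: in_x_def)
  have s: "diag (fps_const fps_X * q) = fps_X * diag q"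
  proof (rule fps_ext)
    fix n
    show "fps_nth (diag (fps_const fps_X * q)) n = fps_nth (fps_X * diag q) n"
      by (cases n) (auto simp add: diag_nth Suc_diff_le)
  qed
  show ?thesis
    using diag_in_x_mult [of fps_X q] by (simp add: X s left_diff_distrib diag_diff)
qed

text \<open>Coefficientwise, the chain rule is the splitting of the total degree
  \<open>Suc n\<close> into the x-exponent i and the s-exponent \<open>Suc n - i\<close>.\<close>

lemma fps_deriv_diag: "fps_deriv (diag h) = diag (fps_deriv h) + diag (deriv_s h)"
proof (rule fps_ext)
  fix n
  let ?a = "\<lambda>i. fps_nth (fps_nth h i) (Suc n - i)"
  have "fps_nth (fps_deriv (diag h)) n = (\<Sum>i\<le>Suc n. of_nat (Suc n) * ?a i)"
    by (simp add: diag_nth sum_distrib_left del: sum.atMost_Suc of_nat_Suc)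
  also have "\<dots> = (\<Sum>i\<le>Suc n. of_nat i * ?a i) + (\<Sum>i\<le>Suc n. of_nat (Suc n - i) * ?a i)"
    unfolding sum.distrib [symmetric]
    by (intro sum.cong refl) (metis atMost_iff distrib_right le_add_diff_inverse of_nat_add)
  also have "(\<Sum>i\<le>Suc n. of_nat i * ?a i) = fps_nth (diag (fps_deriv h)) n"
    by (simp add: diag_nth sum.atMost_Suc_shift fps_of_nat [symmetric]
             del: sum.atMost_Suc of_nat_Suc fps_of_nat)
  also have "(\<Sum>i\<le>Suc n. of_nat (Suc n - i) * ?a i) = fps_nth (diag (deriv_s h)) n"
    by (simp add: diag_nth Suc_diff_le add_diff_eq)
  finally show "fps_nth (fps_deriv (diag h)) n = fps_nth (diag (fps_deriv h) + diag (deriv_s h)) n"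
    by simp
qed

lemma deriv_s_add: "deriv_s (g + h) = deriv_s g + deriv_s h"
  by (rule fps_ext) simp

lemma deriv_s_of_nat_mult: "deriv_s (of_nat k * h) = of_nat k * deriv_s h"
  by (rule fps_ext) (simp add: fps_of_nat [symmetric] del: fps_of_nat)

lemma deriv_s_fps_const: "deriv_s (fps_const g) = fps_const (fps_deriv g)"
  by (rule fps_ext) simp

lemma deriv_s_in_x_mult: "deriv_s (in_x \<phi> * h) = in_x \<phi> * deriv_s h"
  by (rule fps_ext) (simp add: in_x_def fps_mult_nth fps_deriv_sum)

lemma deriv_s_fps_deriv: "deriv_s (fps_deriv h) = fps_deriv (deriv_s h)"
  by (rule fps_ext) (simp add: fps_of_nat [symmetric] del: of_nat_Suc fps_of_nat)

lemma deriv_s_diff_mult: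
  "deriv_s ((fps_X - fps_const fps_X) * q) = (fps_X - fps_const fps_X) * deriv_s q - q"
  by (rule fps_ext) (simp add: left_diff_distrib)

lemma deriv_s_pow_in_x_mult: "(deriv_s ^^ i) (in_x \<phi> * h) = in_x \<phi> * (deriv_s ^^ i) h"
  by (induction i) (simp_all add: deriv_s_in_x_mult)

lemma deriv_s_pow_fps_deriv: "(deriv_s ^^ i) (fps_deriv h) = fps_deriv ((deriv_s ^^ i) h)"
  by (induction i) (simp_all add: deriv_s_fps_deriv)

text \<open>Leibniz rule: x - s has s-derivative -1 and no higher ones, so only two terms of the
  product survive. Exponents \<open>Suc j\<close> keep the lower order j a natural number.\<close>

lemma deriv_s_pow_Suc_decomp:
  "(deriv_s ^^ Suc j) (fps_const g + (fps_X - fps_const fps_X) * q) =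
     fps_const ((D ^^ Suc j) g) + (fps_X - fps_const fps_X) * (deriv_s ^^ Suc j) q
       - of_nat (Suc j) * (deriv_s ^^ j) q"
proof (induction j)
  case 0
  show ?case by (simp add: deriv_s_add deriv_s_fps_const deriv_s_diff_mult)
next
  case (Suc j)
  have diff: "deriv_s (a - b) = deriv_s a - deriv_s b" for a b
    by (rule fps_ext) simp
  have "(deriv_s ^^ Suc (Suc j)) (fps_const g + (fps_X - fps_const fps_X) * q) =
      deriv_s (fps_const ((D ^^ Suc j) g) + (fps_X - fps_const fps_X) * (deriv_s ^^ Suc j) q
       - of_nat (Suc j) * (deriv_s ^^ j) q)"
    using Suc.IH by simp
  also have "\<dots> = fps_const ((D ^^ Suc (Suc j)) g)
       + ((fps_X - fps_const fps_X) * (deriv_s ^^ Suc (Suc j)) q - (deriv_s ^^ Suc j) q)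
       - of_nat (Suc j) * (deriv_s ^^ Suc j) q"
    by (simp only: diff deriv_s_add deriv_s_fps_const deriv_s_diff_mult deriv_s_of_nat_mult
          funpow.simps comp_apply)
  also have "\<dots> = fps_const ((D ^^ Suc (Suc j)) g)
       + (fps_X - fps_const fps_X) * (deriv_s ^^ Suc (Suc j)) q
       - of_nat (Suc (Suc j)) * (deriv_s ^^ Suc j) q"
    by (simp only: of_nat_Suc [of "Suc j"] distrib_right mult_1_left) (simp only: algebra_simps)
  finally show ?case .
qed

section \<open>Diagonal values of the s-derivatives of h and of \<open>K \<omega> h\<close>\<close>

lemma div_diff_decomp: "h = fps_const (diag h) + (fps_X - fps_const fps_X) * div_diff h"
  using theI' [OF div_diff_ex1, of h] by (simp add: div_diff_def)

lemma diag_deriv_s_pow_Suc: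
  "diag ((deriv_s ^^ Suc j) h) =
     (D ^^ Suc j) (diag h) - of_nat (Suc j) * diag ((deriv_s ^^ j) (div_diff h))"
  by (subst div_diff_decomp [of h], subst deriv_s_pow_Suc_decomp)
     (simp only: diag_add diag_diff diag_fps_const diag_diff_mult diag_of_nat_mult add_0_right)

lemma diag_deriv_s_K:
  "diag ((deriv_s ^^ i) (K \<omega> h)) =
     \<sigma> \<omega> (fps_const (1 / (of_nat (i + 1) * of_nat (i + 2))) * (D ^^ (i + 2)) (diag h)
        - fps_const (1 / of_nat (i + 1)) * D (diag ((deriv_s ^^ (i + 1)) h))
        + fps_const (1 / of_nat (i + 2)) * diag ((deriv_s ^^ (i + 2)) h))"
proof -
  define q where "q = div_diff h"
  define g where "g = (D ^^ (i + 2)) (diag h)"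
  define A where "A = D (diag ((deriv_s ^^ i) q))"
  define B where "B = diag ((deriv_s ^^ (i + 1)) q)"
  have nz: "1 + of_nat i \<noteq> (0 :: complex)" "2 + of_nat i \<noteq> (0 :: complex)"
    by (metis of_nat_Suc of_nat_neq_0, metis of_nat_Suc of_nat_neq_0 add.assoc one_add_one)
  have k1: "fps_const (1 / of_nat (i + 1)) * of_nat (i + 1) = (1 :: complex fps)"
    and k2: "fps_const (1 / of_nat (i + 2)) * of_nat (i + 2) = (1 :: complex fps)"
    by (simp_all only: fps_of_nat [symmetric] fps_const_mult) (simp_all add: nz)
  \<comment> \<open>Partial fractions: this choice makes the three multiples of \<open>g\<close>
    cancel at the end.\<close>
  from nz have "1 / (of_nat (i + 1) * of_nat (i + 2)) = 1 / of_nat (i + 1) - 1 / (of_nat (i + 2) :: complex)"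
    by (simp add: field_simps)
  then have k3: "fps_const (1 / (of_nat (i + 1) * of_nat (i + 2))) =
      fps_const (1 / of_nat (i + 1)) - fps_const (1 / of_nat (i + 2) :: complex)"
    by simp
  have u1: "D (diag ((deriv_s ^^ (i + 1)) h)) = g - of_nat (i + 1) * A"
    using diag_deriv_s_pow_Suc [of i h]
    by (simp add: g_def A_def q_def fps_of_nat [symmetric] del: of_nat_Suc of_nat_add fps_of_nat)
  have u2: "diag ((deriv_s ^^ (i + 2)) h) = g - of_nat (i + 2) * B"
    using diag_deriv_s_pow_Suc [of "i + 1" h] by (simp add: g_def B_def q_def)
  \<comment> \<open>The factor \<open>in_x\<close> passes through \<open>deriv_s\<close> and
    \<open>diag\<close>; the chain rule for the i-th s-derivative of \<open>q\<close> then gives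
    \<open>A - B\<close>.\<close>
  have "diag ((deriv_s ^^ i) (K \<omega> h)) = \<sigma> \<omega> (A - B)"
    using fps_deriv_diag [of "(deriv_s ^^ i) q"]
    by (simp add: K_def \<sigma>_def deriv_s_pow_in_x_mult diag_in_x_mult deriv_s_pow_fps_deriv
          A_def B_def q_def)
  also have "A - B = fps_const (1 / (of_nat (i + 1) * of_nat (i + 2))) * g
        - fps_const (1 / of_nat (i + 1)) * (g - of_nat (i + 1) * A)
        + fps_const (1 / of_nat (i + 2)) * (g - of_nat (i + 2) * B)"
    unfolding k3 right_diff_distrib left_diff_distrib mult.assoc [symmetric] k1 k2 by simp
  finally show ?thesis
    unfolding u1 u2 g_def .
qed


section \<open>Linearity and index bound of the operators \<open>\<alpha>\<close>\<close>

lemma foldr_letter_op_mult_add: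
  "foldr (letter_op \<omega>) w (fps_const c * f + g) =
     fps_const c * foldr (letter_op \<omega>) w f + foldr (letter_op \<omega>) w g"
proof (induction w)
  case (Cons l w)
  then show ?case
    by (cases l) (simp_all add: \<sigma>_def distrib_left mult.left_commute)
qed simp

lemma \<sigma>_mult_add: "\<sigma> \<omega> (fps_const c * f + g) = fps_const c * \<sigma> \<omega> f + \<sigma> \<omega> g"
  using foldr_letter_op_mult_add [of \<omega> "[Sigma_letter]"] by simp

lemma fps_deriv_pow_mult_add:
  "(D ^^ k) (fps_const c * f + g) = fps_const c * (D ^^ k) f + (D ^^ k) g"
  by (induction k) simp_all

text \<open>Each step of the recursion raises the lower index by at most 2. The bound replaces
  \<open>Sum_any\<close> by sums over finite ranges.\<close>

lemma \<alpha>_eq_0: "2 * n < i \<Longrightarrow> \<alpha> \<omega> n i = (\<lambda>_. 0)"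
proof (induction n arbitrary: i)
  case (Suc n)
  then obtain k where "i = Suc (Suc k)" "2 * n < k"
    by (metis Suc_less_eq add_2_eq_Suc less_imp_Suc_add mult_Suc_right add_Suc_right)
  with Suc.IH show ?case by simp
qed auto

lemma \<alpha>_Suc_0:
  "\<alpha> \<omega> (Suc n) 0 \<phi> =
     (\<Sum>i\<le>2 * n. fps_const (1 / (of_nat (i + 1) * of_nat (i + 2))) *
                  \<alpha> \<omega> n i (\<sigma> \<omega> ((D ^^ (i + 2)) \<phi>)))"
  unfolding \<alpha>.simps
  by (rule Sum_any.expand_superset) (auto simp: \<alpha>_eq_0 intro: leI)

text \<open>Additivity (c = 1) and homogeneity (g = 0) share one induction. Linearity is what allows
  \<open>\<alpha>\<close> to be expanded on the three-term formula of
  \<open>diag_deriv_s_K\<close>.\<close>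

lemma \<alpha>_mult_add: "\<alpha> \<omega> n i (fps_const c * f + g) = fps_const c * \<alpha> \<omega> n i f + \<alpha> \<omega> n i g"
proof (induction n arbitrary: i f g)
  case (Suc n)
  consider "i = 0" | "i = 1" | k where "i = Suc (Suc k)"
    by (metis One_nat_def not0_implies_Suc)
  then show ?case
  proof cases
    case 1
    show ?thesis
      unfolding 1 \<alpha>_Suc_0 fps_deriv_pow_mult_add \<sigma>_mult_add Suc.IH
      by (simp only: sum_distrib_left sum.distrib [symmetric] distrib_left mult.left_commute)
  next
    case 2
    then show ?thesis
      using fps_deriv_pow_mult_add [of 1] by (simp add: \<sigma>_mult_add Suc.IH)
  next
    case 3
    then show ?thesis
      using fps_deriv_pow_mult_add [of 1]
      by (simp add: \<sigma>_mult_add Suc.IH distrib_left right_diff_distrib mult.left_commute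
            del: of_nat_add of_nat_Suc)
  qed
qed simp

lemma \<alpha>_add: "\<alpha> \<omega> n i (f + g) = \<alpha> \<omega> n i f + \<alpha> \<omega> n i g"
  using \<alpha>_mult_add [of \<omega> n i 1] by simp

lemma \<alpha>_0: "\<alpha> \<omega> n i 0 = 0"
  using \<alpha>_add [of \<omega> n i 0 0] by simp

lemma \<alpha>_mult: "\<alpha> \<omega> n i (fps_const c * f) = fps_const c * \<alpha> \<omega> n i f"
  using \<alpha>_mult_add [of \<omega> n i c f 0] by (simp add: \<alpha>_0)

lemma \<alpha>_diff: "\<alpha> \<omega> n i (f - g) = \<alpha> \<omega> n i f - \<alpha> \<omega> n i g"
  using \<alpha>_add [of \<omega> n i "f - g" g] by (simp add: algebra_simps)

text \<open>The recursion for \<open>\<alpha>\<close> is the transpose of the three-term formula: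
  collecting the right-hand side by the index of \<open>u\<close> instead of by i yields the
  left-hand side.\<close>

lemma \<alpha>_Suc_sum:
  fixes u :: "nat \<Rightarrow> complex fps"
  shows "(\<Sum>i\<le>2 * Suc n. \<alpha> \<omega> (Suc n) i (u i)) =
    (\<Sum>i\<le>2 * n. \<alpha> \<omega> n i (\<sigma> \<omega>
       (fps_const (1 / (of_nat (i + 1) * of_nat (i + 2))) * (D ^^ (i + 2)) (u 0)
        - fps_const (1 / of_nat (i + 1)) * D (u (i + 1))
        + fps_const (1 / of_nat (i + 2)) * u (i + 2))))"
proof -
  define F where "F i = fps_const (1 / (of_nat (i + 1) * of_nat (i + 2))) *
                  \<alpha> \<omega> n i (\<sigma> \<omega> ((D ^^ (i + 2)) (u 0)))" for i
  define G where "G i = fps_const (1 / of_nat (i + 1)) * \<alpha> \<omega> n i (\<sigma> \<omega> (D (u (i + 1))))" for i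
  define H where "H i = fps_const (1 / of_nat (i + 2)) * \<alpha> \<omega> n i (\<sigma> \<omega> (u (i + 2)))" for i
  have \<sigma>_diff: "\<sigma> \<omega> (f - g) = \<sigma> \<omega> f - \<sigma> \<omega> g" and \<sigma>_add: "\<sigma> \<omega> (f + g) = \<sigma> \<omega> f + \<sigma> \<omega> g"
    and \<sigma>_mult: "\<sigma> \<omega> (fps_const c * f) = fps_const c * \<sigma> \<omega> f" for c f g
    by (simp_all add: \<sigma>_def algebra_simps)
  \<comment> \<open>The index 2n + 1 lies beyond the bound, so shifting the sum of \<open>G\<close>
    by one leaves no boundary term at the top.\<close>
  have "G (Suc (2 * n)) = 0"
    by (simp add: G_def \<alpha>_eq_0)
  then have G: "(\<Sum>i\<le>2 * n. G i) = G 0 + (\<Sum>i\<le>2 * n. G (Suc i))"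
    using sum.atMost_Suc_shift [of G "2 * n"] by simp
  have "(\<Sum>i\<le>2 * Suc n. \<alpha> \<omega> (Suc n) i (u i)) =
      \<alpha> \<omega> (Suc n) 0 (u 0) + \<alpha> \<omega> (Suc n) (Suc 0) (u 1)
      + (\<Sum>i\<le>2 * n. \<alpha> \<omega> (Suc n) (Suc (Suc i)) (u (i + 2)))"
    by (simp add: sum.atMost_Suc_shift del: sum.atMost_Suc \<alpha>.simps)
  \<comment> \<open>Lower index 0 gives the sum of \<open>F\<close>, index 1 gives
    \<open>- G 0\<close>, and index i + 2 gives \<open>H i - G (Suc i)\<close>, both with the factor
    1/(i + 2).\<close>
  also have "\<dots> = sum F {..2 * n} - G 0 + (\<Sum>i\<le>2 * n. H i - G (Suc i))"
    unfolding \<alpha>_Suc_0 F_def G_def H_def by (simp add: right_diff_distrib)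
  also have "\<dots> = (\<Sum>i\<le>2 * n. F i - G i + H i)"
    by (simp add: sum.distrib sum_subtractf G)
  finally show ?thesis
    by (simp only: F_def G_def H_def \<sigma>_add \<sigma>_diff \<sigma>_mult \<alpha>_add \<alpha>_diff \<alpha>_mult)
qed

section \<open>Iteration of K\<close>

lemma diag_K_pow: "diag ((K \<omega> ^^ n) h) = (\<Sum>i\<le>2 * n. \<alpha> \<omega> n i (diag ((deriv_s ^^ i) h)))"
proof (induction n arbitrary: h)
  case (Suc n)
  \<comment> \<open>The innermost K is split off, so the induction hypothesis is applied to
    \<open>K \<omega> h\<close>; hence h must be arbitrary.\<close>
  have "diag ((K \<omega> ^^ Suc n) h) = (\<Sum>i\<le>2 * n. \<alpha> \<omega> n i (diag ((deriv_s ^^ i) (K \<omega> h))))"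
    by (simp only: funpow_Suc_right comp_apply Suc.IH)
  then show ?case
    unfolding \<alpha>_Suc_sum [where u = "\<lambda>i. diag ((deriv_s ^^ i) h)"] diag_deriv_s_K by simp
qed simp

lemma T_eq_\<alpha>: "T \<omega> n \<phi> = \<alpha> \<omega> n 0 \<phi>"
proof -
  have "deriv_s (in_x \<phi>) = 0"
    by (rule fps_ext) (simp add: in_x_def)
  moreover have "(deriv_s ^^ i) 0 = 0" for i
  proof (induction i)
    case (Suc i)
    then show ?case by (simp add: fps_eq_iff)
  qed simp
  ultimately have "(deriv_s ^^ i) (in_x \<phi>) = (if i = 0 then in_x \<phi> else 0)" for i
    by (cases i) (simp_all add: funpow_Suc_right del: funpow.simps)
  then have "T \<omega> n \<phi> = (\<Sum>i\<le>2 * n. if i = 0 then \<alpha> \<omega> n 0 \<phi> else 0)"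
    unfolding T_def diag_K_pow by (intro sum.cong) (auto simp: \<alpha>_0)
  then show ?thesis by simp
qed

section \<open>Noncommutative polynomials as operators\<close>

lemma nc_op_superset:
  assumes "finite A" "Poly_Mapping.keys p \<subseteq> A"
  shows "nc_op \<omega> p \<phi> =
    (\<Sum>w\<in>A. fps_const (Poly_Mapping.lookup p w) * foldr (letter_op \<omega>) w \<phi>)"
  unfolding nc_op_def using assms by (intro sum.mono_neutral_left) (auto simp: in_keys_iff)

lemma nc_op_0 [simp]: "nc_op \<omega> 0 \<phi> = 0"
  by (simp add: nc_op_def)

lemma nc_op_add: "nc_op \<omega> (p + q) \<phi> = nc_op \<omega> p \<phi> + nc_op \<omega> q \<phi>"
proof -
  let ?A = "Poly_Mapping.keys p \<union> Poly_Mapping.keys q"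
  show ?thesis
    using Poly_Mapping.keys_add [of p q]
    by (simp add: nc_op_superset [of ?A] lookup_add fps_const_add [symmetric] distrib_right
          sum.distrib del: fps_const_add)
qed

lemma nc_op_diff: "nc_op \<omega> (p - q) \<phi> = nc_op \<omega> p \<phi> - nc_op \<omega> q \<phi>"
  using nc_op_add [of \<omega> "p - q" q] by simp

lemma nc_op_sum: "nc_op \<omega> (\<Sum>i\<in>I. p i) \<phi> = (\<Sum>i\<in>I. nc_op \<omega> (p i) \<phi>)"
  by (induction I rule: infinite_finite_induct) (simp_all add: nc_op_add)

lemma nc_op_single:
  "nc_op \<omega> (Poly_Mapping.single w c) \<phi> = fps_const c * foldr (letter_op \<omega>) w \<phi>"
  by (simp add: nc_op_def)

text \<open>Concatenation of words becomes composition under \<open>foldr\<close>, the right-hand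
  word acting first. Right multiplication by a monomial is the only product occurring in
  \<open>\<nu>_term\<close>.\<close>

lemma nc_op_mult_single:
  "nc_op \<omega> (p * Poly_Mapping.single w c) \<phi> = fps_const c * nc_op \<omega> p (foldr (letter_op \<omega>) w \<phi>)"
proof -
  have "p = (\<Sum>v\<in>Poly_Mapping.keys p. Poly_Mapping.single v (Poly_Mapping.lookup p v))"
    by (rule poly_mapping_eqI)
       (auto simp: lookup_sum lookup_single when_def in_keys_iff)
  then have "p * Poly_Mapping.single w c =
      (\<Sum>v\<in>Poly_Mapping.keys p. Poly_Mapping.single (v + w) (Poly_Mapping.lookup p v * c))"
    by (metis (no_types, lifting) mult_single sum.cong sum_distrib_right)
  then have "nc_op \<omega> (p * Poly_Mapping.single w c) \<phi> =
      (\<Sum>v\<in>Poly_Mapping.keys p. fps_const (Poly_Mapping.lookup p v * c) *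
        foldr (letter_op \<omega>) v (foldr (letter_op \<omega>) w \<phi>))"
    by (simp only: nc_op_sum nc_op_single plus_list_def foldr_append comp_apply)
  then show ?thesis
    by (simp add: nc_op_def sum_distrib_left mult_ac flip: fps_const_mult)
qed

lemma lookup_\<nu>:
  "Poly_Mapping.lookup (\<nu> e) k =
     (\<Sum>i\<in>Poly_Mapping.keys e. Poly_Mapping.lookup (\<nu>_term (Poly_Mapping.lookup e i) i) k)"
  by (simp add: \<nu>_def lookup_sum)

lemma nc_op_\<nu>_term:
  "nc_op \<omega> (Poly_Mapping.lookup (\<nu>_term a i) k) \<phi> =
     (if k = 0 then fps_const (1 / (of_nat (i + 1) * of_nat (i + 2))) *
        nc_op \<omega> a (\<sigma> \<omega> ((D ^^ (i + 2)) \<phi>)) else 0)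
   - (if k = i + 1 then fps_const (1 / of_nat (i + 1)) * nc_op \<omega> a (\<sigma> \<omega> (D \<phi>)) else 0)
   + (if k = i + 2 then fps_const (1 / of_nat (i + 2)) * nc_op \<omega> a (\<sigma> \<omega> \<phi>) else 0)"
proof -
  have "foldr (letter_op \<omega>) (replicate j D_letter) = D ^^ j" for j
    by (induction j) auto
  then have "foldr (letter_op \<omega>) (Sigma_letter # replicate j D_letter) \<phi> = \<sigma> \<omega> ((D ^^ j) \<phi>)" for j
    by simp
  then show ?thesis
    unfolding \<nu>_term_def lookup_add lookup_minus lookup_single when_def nc_op_add nc_op_diff
    by (simp add: nc_op_mult_single if_distrib [of "\<lambda>p. nc_op \<omega> p \<phi>"] del: of_nat_add of_nat_Suc
          replicate.simps funpow.simps cong: if_cong)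
qed

lemma \<alpha>_eq_nc_op:
  "\<alpha> \<omega> n i = nc_op \<omega> (Poly_Mapping.lookup ((\<nu> ^^ n) (Poly_Mapping.single 0 1)) i)"
proof (induction n arbitrary: i)
  case 0
  \<comment> \<open>The unit is the empty word with coefficient 1, which acts as the
    identity.\<close>
  have "nc_op \<omega> 1 \<phi> = \<phi>" for \<phi>
    unfolding single_one [symmetric] nc_op_single by (simp add: zero_list_def)
  then show ?case
    by (auto simp: fun_eq_iff lookup_single when_def simp del: single_one)
next
  case (Suc n)
  define e where "e = (\<nu> ^^ n) (Poly_Mapping.single 0 1)"
  let ?I = "Poly_Mapping.keys e"
  have IH: "nc_op \<omega> (Poly_Mapping.lookup e j) = \<alpha> \<omega> n j" for j
    unfolding e_def by (rule Suc.IH [symmetric])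
  \<comment> \<open>Outside the support of \<open>e\<close> the operators vanish, so sums over
    \<open>?I\<close> capture every nonzero term of the recursion.\<close>
  have zero: "\<alpha> \<omega> n j \<phi> = 0" if "j \<notin> ?I" for j \<phi>
    using that by (simp add: in_keys_iff flip: IH)
  have "\<alpha> \<omega> (Suc n) i \<phi> = nc_op \<omega> (Poly_Mapping.lookup (\<nu> e) i) \<phi>" for \<phi>
  proof -
    consider "i = 0" | "i = Suc 0" | k where "i = Suc (Suc k)"
      by (metis not0_implies_Suc)
    then show ?thesis
    proof cases
      case 1
      have "\<alpha> \<omega> (Suc n) 0 \<phi> =
          (\<Sum>j\<in>?I. fps_const (1 / (of_nat (j + 1) * of_nat (j + 2))) *
                    \<alpha> \<omega> n j (\<sigma> \<omega> ((D ^^ (j + 2)) \<phi>)))"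
        unfolding \<alpha>.simps by (rule Sum_any.expand_superset) (use zero in auto)
      then show ?thesis
        by (simp add: 1 lookup_\<nu> nc_op_sum nc_op_\<nu>_term IH del: \<alpha>.simps)
    next
      case 2
      then show ?thesis
        by (auto simp: lookup_\<nu> nc_op_sum nc_op_\<nu>_term IH zero sum_negf cong: if_cong)
    next
      case 3
      \<comment> \<open>Only j = k, through j + 2, and j = k + 1, through j + 1, reach the index k +
        2; both carry the factor 1/(k + 2).\<close>
      have "nc_op \<omega> (Poly_Mapping.lookup (\<nu> e) i) \<phi> =
          (\<Sum>j\<in>?I. if j = k then fps_const (1 / of_nat (k + 2)) * \<alpha> \<omega> n k (\<sigma> \<omega> \<phi>) else 0)
          - (\<Sum>j\<in>?I. if j = k + 1
               then fps_const (1 / of_nat (k + 2)) * \<alpha> \<omega> n (k + 1) (\<sigma> \<omega> (D \<phi>)) else 0)"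
        unfolding lookup_\<nu> nc_op_sum nc_op_\<nu>_term IH sum_subtractf [symmetric]
        by (intro sum.cong) (auto simp: 3)
      then show ?thesis
        by (simp add: 3 zero right_diff_distrib)
    qed
  qed
  then show ?case
    by (simp add: e_def fun_eq_iff)
qed

theorem theorem1p1:
  fixes f \<omega> :: "complex fps"
  assumes "fps_nth f 0 = 0" and "fps_nth f 1 = 1"
    and "fps_nth \<omega> 0 = 0" and "fps_nth \<omega> 1 = 1"
    and "\<omega> = fps_inv (f / fps_deriv f)"
  shows "(\<forall>n. finite {i. \<alpha> \<omega> n i \<noteq> (\<lambda>_. 0)})
    \<and> (\<forall>n i. \<alpha> \<omega> n i
           = nc_op \<omega> (Poly_Mapping.lookup ((\<nu> ^^ n) (Poly_Mapping.single 0 1)) i))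
    \<and> (\<forall>n \<phi>. T \<omega> n \<phi> = \<alpha> \<omega> n 0 \<phi>)
    \<and> (\<forall>\<phi>. T \<omega> 1 \<phi> = fps_const (1 / 2) * \<sigma> \<omega> ((D ^^ 2) \<phi>))"
proof (intro conjI allI)
  show "finite {i. \<alpha> \<omega> n i \<noteq> (\<lambda>_. 0)}" for n
    by (rule finite_subset [of _ "{..2 * n}"]) (use \<alpha>_eq_0 leI in auto)
  \<comment> \<open>For upper index 0 the sum in \<open>\<alpha>_Suc_0\<close> has the single term i
    = 0, with coefficient 1/(1 * 2).\<close>
  show "T \<omega> 1 \<phi> = fps_const (1 / 2) * \<sigma> \<omega> ((D ^^ 2) \<phi>)" for \<phi>
    unfolding T_eq_\<alpha> One_nat_def \<alpha>_Suc_0 by (simp add: numeral_2_eq_2)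
qed (rule \<alpha>_eq_nc_op T_eq_\<alpha>)+

end
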